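(* Let $k\geqslant 2$ be an integer. The limiting distribution of $\omega_k(n)$, i.e. the distribution of a random variable $X_k$ taking each value $m\in\{0,1,2,\dots\}$ with probability $e_{k,m}$, has expectation $$\sum_{p} \frac{p-1}{p^{k+1}}$$ and variance $$\sum_p \frac{p-1}{p^{k+1}} \Bigl( 1 - \frac{p-1}{p^{k+1}} \Bigr).$$
   Context: For a positive integer $n$, $\omega_k(n)$ is the number of primes $p$ with $p^k\,\|\,n$ (primes dividing $n$ with multiplicity exactly $k$). For integers $m\geqslant0$, $e_{k,m}=\lim_{x\to\infty}\frac1x\#\{n\leqslant x:\omega_k(n)=m\}$ is the natural density of the positive integers $n$ with $\omega_k(n)=m$; these limits exist, are nonnegative, and satisfy $\sum_{m\geqslant0}e_{k,m}=1$. $\sum_p$ denotes a sum over all primes. *)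

theory Defs
  imports "HOL-Probability.Probability" "HOL-Computational_Algebra.Computational_Algebra"
begin

definition omega_exact :: "nat \<Rightarrow> nat \<Rightarrow> nat" where
  "omega_exact k n = card {p::nat. prime p \<and> multiplicity p n = k}"

text \<open>\<^const>\<open>Lim\<close> is unspecified where no limit exists; the natural densities below do exist
  for all \<open>k \<ge> 1\<close> and all \<open>m\<close>.\<close>

definition omega_density :: "nat \<Rightarrow> nat \<Rightarrow> real" where
  "omega_density k m =
     Lim at_top (\<lambda>x::real. real (card {n::nat. 0 < n \<and> real n \<le> x \<and> omega_exact k n = m}) / x)"

end

theory Submission
  imports Defs
begin

text \<open>
  Write \<open>b\<^sub>p = (p - 1) / p ^ (k + 1) = p ^ -k - p ^ -(k + 1)\<close>, the density of the integers that
  \<open>p\<close> divides exactly \<open>k\<close> times. For distinct primes these events are independent, so the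
  distribution of \<open>\<omega>\<^sub>k\<close> is that of a sum of independent Bernoulli variables with success
  probabilities \<open>b\<^sub>p\<close>. Such a sum has mean \<open>\<Sum> b\<^sub>p\<close> and variance \<open>\<Sum> b\<^sub>p (1 - b\<^sub>p)\<close>. What has
  to be justified is the passage from finitely many primes to all of them, for the densities and then
  for the moments.

  For a finite set \<open>P\<close> of primes, the number of \<open>p \<in> P\<close> with multiplicity exactly \<open>k\<close> takes the value
  \<open>m\<close> with density the coefficient of \<open>z ^ m\<close> in \<open>\<Prod>p\<in>P. 1 - b\<^sub>p + b\<^sub>p z\<close>
  (\<open>has_density_omega_on\<close>). Independence comes from dilations: if membership in \<open>A\<close> does not
  change under multiplication by \<open>p\<close>, the members of \<open>A\<close> with multiplicity \<open>k\<close> at \<open>p\<close> form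
  \<open>p ^ k A - p ^ (k + 1) A\<close>, and dilation by \<open>q\<close> divides a density by \<open>q\<close>.

  Restricting to the primes below \<open>N\<close> alters \<open>\<omega>\<^sub>k(n)\<close> only if \<open>j\<^sup>2\<close> divides \<open>n\<close> for some \<open>j \<ge> N\<close>; here
  \<open>k \<ge> 2\<close> enters. At most \<open>x \<Sum>j\<ge>N. 1 / j\<^sup>2\<close> of the \<open>n \<le> x\<close> are affected, a proportion that tends to
  \<open>0\<close> uniformly in \<open>x\<close>. Hence the densities \<open>e\<^sub>k\<^sub>,\<^sub>m\<close> exist and are the limits of the densities for the
  primes below \<open>N\<close> (\<open>omega_density_limit\<close>).

  The generating functions are bounded at \<open>z = 8\<close> uniformly in \<open>N\<close>, because \<open>\<Sum> b\<^sub>p\<close> converges. Their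
  coefficients therefore decay geometrically and uniformly, and by dominated convergence the moments
  up to order two converge to those of the limit law (\<open>moments_tendsto\<close>). At finite level the first
  moment and second factorial moment are the derivatives of the generating function at \<open>1\<close>.
\<close>

section \<open>Natural density\<close>

definition counting :: "nat set \<Rightarrow> real \<Rightarrow> nat" where
  "counting A x = card {n \<in> A. 0 < n \<and> real n \<le> x}"

definition has_density :: "nat set \<Rightarrow> real \<Rightarrow> bool" where
  "has_density A d \<longleftrightarrow> ((\<lambda>x. real (counting A x) / x) \<longlongrightarrow> d) at_top"

lemma finite_upto: "finite {n \<in> A. 0 < n \<and> real n \<le> x}"
  by (rule finite_subset[of _ "{..nat \<lfloor>x\<rfloor>}"]) (auto simp: le_nat_floor)

lemma counting_UNIV: "counting UNIV x = nat \<lfloor>x\<rfloor>"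
proof -
  have "{n \<in> UNIV. 0 < n \<and> real n \<le> x} = {1..nat \<lfloor>x\<rfloor>}"
    by (auto simp: le_nat_floor) linarith
  then show ?thesis
    unfolding counting_def by simp
qed

lemma counting_mono: "A \<subseteq> B \<Longrightarrow> counting A x \<le> counting B x"
  unfolding counting_def by (rule card_mono[OF finite_upto]) auto

lemma counting_le: "x \<ge> 0 \<Longrightarrow> real (counting A x) \<le> x"
  using counting_mono[of A UNIV x] by (simp add: counting_UNIV) linarith

lemma counting_Un: "counting (A \<union> B) x \<le> counting A x + counting B x"
proof -
  have eq: "{n \<in> A \<union> B. 0 < n \<and> real n \<le> x} =
      {n \<in> A. 0 < n \<and> real n \<le> x} \<union> {n \<in> B. 0 < n \<and> real n \<le> x}" by auto
  show ?thesis
    unfolding counting_def eq by (rule card_Un_le)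
qed

lemma counting_disjoint_Un:
  assumes "A \<inter> B = {}"
  shows "counting (A \<union> B) x = counting A x + counting B x"
proof -
  have eq: "{n \<in> A \<union> B. 0 < n \<and> real n \<le> x} =
      {n \<in> A. 0 < n \<and> real n \<le> x} \<union> {n \<in> B. 0 < n \<and> real n \<le> x}" by auto
  show ?thesis
    unfolding counting_def eq using assms by (intro card_Un_disjoint finite_upto) auto
qed

lemma counting_dilate:
  assumes "q > 0"
  shows "counting ((*) q ` A) x = counting A (x / real q)"
proof -
  have "{n \<in> (*) q ` A. 0 < n \<and> real n \<le> x} = (*) q ` {n \<in> A. 0 < n \<and> real n \<le> x / real q}"
    using assms by (auto simp: field_simps)
  moreover have "inj_on ((*) q) S" for S :: "nat set"
    using assms by (auto simp: inj_on_def)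
  ultimately show ?thesis
    unfolding counting_def by (simp add: card_image)
qed

lemma counting_multiples_le:
  assumes "q > 0" "x \<ge> 0"
  shows "real (counting {n. q dvd n} x) \<le> x / real q"
proof -
  have "{n. q dvd n} = (*) q ` UNIV" by (auto simp: dvd_def)
  then show ?thesis
    using counting_dilate[OF assms(1), of UNIV x] counting_le[of "x / real q" UNIV] assms by simp
qed

lemma has_density_UNIV: "has_density UNIV 1"
proof -
  have "((\<lambda>x::real. real (nat \<lfloor>x\<rfloor>) / x) \<longlongrightarrow> 1) at_top"
  proof (rule tendsto_sandwich)
    show "\<forall>\<^sub>F x::real in at_top. 1 - 1 / x \<le> real (nat \<lfloor>x\<rfloor>) / x"
      using eventually_gt_at_top[of 1]
    proof eventually_elim
      case (elim x)
      then have "x - 1 \<le> real (nat \<lfloor>x\<rfloor>)" by linarith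
      then have "(x - 1) / x \<le> real (nat \<lfloor>x\<rfloor>) / x"
        using elim by (intro divide_right_mono) auto
      then show ?case using elim by (simp add: diff_divide_distrib)
    qed
    show "\<forall>\<^sub>F x::real in at_top. real (nat \<lfloor>x\<rfloor>) / x \<le> 1"
      using eventually_gt_at_top[of 1] by eventually_elim (auto simp: field_simps)
    have "((\<lambda>x::real. 1 - 1 / x) \<longlongrightarrow> 1 - 0) at_top"
      by (intro tendsto_intros tendsto_divide_0[OF tendsto_const] filterlim_at_top_imp_at_infinity filterlim_ident)
    then show "((\<lambda>x::real. 1 - 1 / x) \<longlongrightarrow> 1) at_top" by simp
  qed simp
  then show ?thesis by (simp add: has_density_def counting_UNIV)
qed

lemma has_density_dilate:
  assumes "has_density A d" "q > 0"
  shows "has_density ((*) q ` A) (d / real q)"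
proof -
  have "filterlim (\<lambda>x::real. x * (1 / real q)) at_top at_top"
    using assms(2) by (intro filterlim_at_top_mult_tendsto_pos[OF tendsto_const] filterlim_ident) auto
  then have "((\<lambda>x. real (counting A (x / real q)) / (x / real q)) \<longlongrightarrow> d) at_top"
    using filterlim_compose[OF assms(1)[unfolded has_density_def], of "\<lambda>x. x / real q"] by simp
  then have "((\<lambda>x. real (counting A (x / real q)) / (x / real q) / real q) \<longlongrightarrow> d / real q) at_top"
    using assms(2) by (intro tendsto_divide tendsto_const) auto
  then show ?thesis
    using assms(2) by (simp add: has_density_def counting_dilate)
qed

lemma has_density_disjoint_Un:
  assumes "has_density A c" "has_density B d" "A \<inter> B = {}"
  shows "has_density (A \<union> B) (c + d)"
  using tendsto_add[OF assms(1,2)[unfolded has_density_def]]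
  by (simp add: has_density_def counting_disjoint_Un[OF assms(3)] add_divide_distrib)

lemma has_density_Diff:
  assumes "has_density A c" "has_density B d" "B \<subseteq> A"
  shows "has_density (A - B) (c - d)"
proof -
  have "counting A x = counting (A - B) x + counting B x" for x
  proof -
    have "A - B \<union> B = A" "(A - B) \<inter> B = {}" using assms(3) by auto
    then show ?thesis using counting_disjoint_Un[of "A - B" B x] by simp
  qed
  then have "real (counting (A - B) x) / x = real (counting A x) / x - real (counting B x) / x" for x
    by (simp add: diff_divide_distrib[symmetric])
  then show ?thesis
    using tendsto_diff[OF assms(1,2)[unfolded has_density_def]] by (simp add: has_density_def)
qed

lemma counting_pos: "counting {n. 0 < n \<and> P n} x = counting {n. P n} x"
  unfolding counting_def by (rule arg_cong[of _ _ card]) auto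

section \<open>Finitely many primes\<close>

definition exact_prob :: "nat \<Rightarrow> nat \<Rightarrow> real" where
  "exact_prob k p = (real p - 1) / real p ^ (k + 1)"

text \<open>The probability generating function of a sum of independent Bernoulli variables, one for
  each \<open>p \<in> P\<close>.\<close>

definition bernoulli_gf :: "nat \<Rightarrow> nat set \<Rightarrow> real poly" where
  "bernoulli_gf k P = (\<Prod>p\<in>P. [:1 - exact_prob k p, exact_prob k p:])"

definition omega_on :: "nat set \<Rightarrow> nat \<Rightarrow> nat \<Rightarrow> nat" where
  "omega_on P k n = card {p \<in> P. multiplicity p n = k}"

lemma exact_prob_eq:
  assumes "p > 0"
  shows "exact_prob k p = 1 / real (p ^ k) - 1 / real (p ^ Suc k)"
  using assms by (simp add: exact_prob_def field_simps)

lemma exact_prob_nonneg: "p > 0 \<Longrightarrow> exact_prob k p \<ge> 0"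
  by (simp add: exact_prob_def)

lemma exact_prob_le: "p > 0 \<Longrightarrow> exact_prob k p \<le> 1 / real p ^ k"
  by (simp add: exact_prob_eq)

lemma exact_prob_le_1: "p > 0 \<Longrightarrow> exact_prob k p \<le> 1"
proof -
  assume "p > 0"
  then have "1 / real p ^ k \<le> 1"
    by (simp add: divide_le_eq_1 one_le_power)
  then show ?thesis
    using exact_prob_le[OF \<open>p > 0\<close>, of k] by linarith
qed

lemma omega_on_dilate:
  assumes "\<And>q. q \<in> P \<Longrightarrow> prime q" "prime p" "p \<notin> P" "n > 0"
  shows "omega_on P k (p ^ j * n) = omega_on P k n"
proof -
  have "multiplicity q (p ^ j * n) = multiplicity q n" if "q \<in> P" for q
  proof -
    have q: "prime q" "q \<noteq> p" using assms that by auto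
    then have "multiplicity q (p ^ j) = 0"
      using assms(2) by (metis not_dvd_imp_multiplicity_0 prime_dvd_power primes_dvd_imp_eq)
    then show ?thesis
      using q assms by (subst prime_elem_multiplicity_mult_distrib) auto
  qed
  then show ?thesis
    unfolding omega_on_def by (intro arg_cong[of _ _ card]) auto
qed

lemma omega_on_insert:
  assumes "finite P" "p \<notin> P"
  shows "omega_on (insert p P) k n = omega_on P k n + (if multiplicity p n = k then 1 else 0)"
proof -
  have "{q \<in> insert p P. multiplicity q n = k} =
     (if multiplicity p n = k then insert p {q \<in> P. multiplicity q n = k} else {q \<in> P. multiplicity q n = k})"
    by auto
  then show ?thesis using assms by (simp add: omega_on_def)
qed

text \<open>The condition on \<open>p\<close> is independent of every set that cannot see the prime \<open>p\<close>: for such a set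
  \<open>A\<close>, the multiples of \<open>p ^ j\<close> in \<open>A\<close> are the dilate \<open>p ^ j A\<close>, of density \<open>d / p ^ j\<close>.\<close>

lemma has_density_exact_Int:
  fixes A :: "nat set"
  assumes A: "has_density A d" and p: "prime p"
    and inv: "\<And>j n. n > 0 \<Longrightarrow> p ^ j * n \<in> A \<longleftrightarrow> n \<in> A"
    and pos: "\<And>n. n \<in> A \<Longrightarrow> n > 0"
  shows "has_density {n \<in> A. multiplicity p n = k} (exact_prob k p * d)"
proof -
  have p0: "p > 0" using p prime_gt_0_nat by blast
  have img: "(*) (p ^ j) ` A = {n \<in> A. p ^ j dvd n}" for j
  proof (intro equalityI subsetI)
    fix n assume "n \<in> {n \<in> A. p ^ j dvd n}"
    then obtain m where "n = p ^ j * m" "n \<in> A" by (auto simp: dvd_def)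
    moreover from this pos have "m > 0" by fastforce
    ultimately show "n \<in> (*) (p ^ j) ` A" using inv by auto
  qed (use inv pos in auto)
  have "{n \<in> A. multiplicity p n = k} = (*) (p ^ k) ` A - (*) (p ^ Suc k) ` A"
  proof -
    have "multiplicity p n = k \<longleftrightarrow> p ^ k dvd n \<and> \<not> p ^ Suc k dvd n" if "n \<in> A" for n
    proof -
      have "n \<noteq> 0" "\<not> is_unit p" using pos[OF that] p by auto
      then show ?thesis
        using power_dvd_iff_le_multiplicity[of n p k] power_dvd_iff_le_multiplicity[of n p "Suc k"]
        by auto
    qed
    then show ?thesis unfolding img by auto
  qed
  moreover have "has_density ((*) (p ^ k) ` A - (*) (p ^ Suc k) ` A) (d / real (p ^ k) - d / real (p ^ Suc k))"
  proof (rule has_density_Diff)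
    show "(*) (p ^ Suc k) ` A \<subseteq> (*) (p ^ k) ` A"
      unfolding img by (auto dest: dvd_mult_right)
  qed (rule has_density_dilate[OF A], use p0 in simp)+
  moreover have "d / real (p ^ k) - d / real (p ^ Suc k) = exact_prob k p * d"
    using exact_prob_eq[OF p0, of k] by (simp add: left_diff_distrib)
  ultimately show ?thesis by simp
qed

text \<open>Adding a prime \<open>p\<close> to \<open>P\<close> multiplies the generating function by \<open>1 - b + b z\<close>: the value \<open>m\<close>
  arises from \<open>m\<close> when the multiplicity of \<open>p\<close> differs from \<open>k\<close>, and from \<open>m - 1\<close> when it is \<open>k\<close>.\<close>

lemma has_density_omega_on:
  assumes "finite P" "\<And>p. p \<in> P \<Longrightarrow> prime p"
  shows "has_density {n. 0 < n \<and> omega_on P k n = m} (coeff (bernoulli_gf k P) m)"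
  using assms
proof (induction P arbitrary: m rule: finite_induct)
  case empty
  show ?case
  proof (cases m)
    case 0
    have "counting {n. 0 < n} = counting UNIV"
      using counting_pos[of "\<lambda>_. True"] by auto
    then show ?thesis
      using has_density_UNIV 0 by (simp add: bernoulli_gf_def omega_on_def has_density_def)
  next
    case (Suc j)
    then show ?thesis by (simp add: bernoulli_gf_def omega_on_def has_density_def counting_def)
  qed
next
  case (insert p P)
  define b where "b = exact_prob k p"
  define c where "c = coeff (bernoulli_gf k P)"
  define A where "A m = {n. 0 < n \<and> omega_on P k n = m}" for m
  define E where "E m = {n \<in> A m. multiplicity p n = k}" for m
  have p: "prime p" and P: "\<And>q. q \<in> P \<Longrightarrow> prime q" using insert.prems by auto
  have A: "has_density (A m) (c m)" for m
    using insert.IH[OF P] by (simp add: A_def c_def)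
  have E: "has_density (E m) (b * c m)" for m
    unfolding E_def b_def using p prime_gt_0_nat[OF p] omega_on_dilate[OF P p insert.hyps(2)]
    by (intro has_density_exact_Int A) (auto simp: A_def)
  have EA: "E m \<subseteq> A m" for m by (auto simp: E_def)
  have gf: "bernoulli_gf k (insert p P) = [:1 - b, b:] * bernoulli_gf k P"
    using insert.hyps by (simp add: bernoulli_gf_def b_def)
  show ?case
  proof (cases m)
    case 0
    have "{n. 0 < n \<and> omega_on (insert p P) k n = m} = A m - E m"
      using 0 by (auto simp: A_def E_def omega_on_insert[OF insert.hyps(1,2)])
    moreover have "coeff (bernoulli_gf k (insert p P)) m = c m - b * c m"
      by (simp add: gf 0 c_def algebra_simps)
    ultimately show ?thesis
      using has_density_Diff[OF A E EA] by simp
  next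
    case (Suc j)
    have "{n. 0 < n \<and> omega_on (insert p P) k n = m} = (A m - E m) \<union> E j"
      using Suc by (auto simp: A_def E_def omega_on_insert[OF insert.hyps(1,2)])
    moreover have "coeff (bernoulli_gf k (insert p P)) m = (c m - b * c m) + b * c j"
      by (simp add: gf Suc c_def algebra_simps)
    moreover have "(A m - E m) \<inter> E j = {}"
      using Suc by (auto simp: A_def E_def)
    ultimately show ?thesis
      using has_density_disjoint_Un[OF has_density_Diff[OF A E EA] E] by simp
  qed
qed

section \<open>All primes\<close>

lemma summable_inverse_square: "summable (\<lambda>j::nat. 1 / real j ^ 2)"
  using inverse_power_summable[of 2, where 'a=real] by (simp add: field_simps)

text \<open>A union bound. The series starts at \<open>N > 0\<close>, which keeps out the term \<open>j = 0\<close>, whose value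
  \<open>1 / 0 = 0\<close> would bound nothing.\<close>

lemma counting_square_multiples_le:
  assumes "N > 0" "x \<ge> 0"
  shows "real (counting {n. \<exists>j\<ge>N. j ^ 2 dvd n} x) \<le> x * (\<Sum>j. 1 / real (j + N) ^ 2)"
proof -
  define J where "J = nat \<lfloor>x\<rfloor>"
  let ?U = "\<lambda>j. {n. 0 < n \<and> real n \<le> x \<and> j ^ 2 dvd n}"
  have "{n \<in> {n. \<exists>j\<ge>N. j ^ 2 dvd n}. 0 < n \<and> real n \<le> x} \<subseteq> (\<Union>j\<in>{N..J + N}. ?U j)"
  proof
    fix n assume n: "n \<in> {n \<in> {n. \<exists>j\<ge>N. j ^ 2 dvd n}. 0 < n \<and> real n \<le> x}"
    then obtain j where j: "j \<ge> N" "j ^ 2 dvd n" by auto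
    have "j \<le> j ^ 2" by (simp add: power2_eq_square)
    also have "\<dots> \<le> n" using j n by (auto intro: dvd_imp_le)
    also have "n \<le> J" using n by (auto simp: J_def le_nat_floor)
    finally show "n \<in> (\<Union>j\<in>{N..J + N}. ?U j)" using j n by auto
  qed
  moreover have fin: "finite (?U j)" for j
    using finite_upto[of "{n. j ^ 2 dvd n}" x] by (rule finite_subset[rotated]) auto
  ultimately have "counting {n. \<exists>j\<ge>N. j ^ 2 dvd n} x \<le> card (\<Union>j\<in>{N..J + N}. ?U j)"
    unfolding counting_def by (intro card_mono) auto
  also have "\<dots> \<le> (\<Sum>j\<in>{N..J + N}. card (?U j))"
    by (rule card_UN_le) auto
  finally have "real (counting {n. \<exists>j\<ge>N. j ^ 2 dvd n} x) \<le> (\<Sum>j\<in>{N..J + N}. real (card (?U j)))"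
    by (simp only: of_nat_le_iff flip: of_nat_sum)
  also have "\<dots> \<le> (\<Sum>j\<in>{N..J + N}. x * (1 / real j ^ 2))"
  proof (rule sum_mono)
    fix j assume "j \<in> {N..J + N}"
    then have "j ^ 2 > 0" using assms by auto
    then show "real (card (?U j)) \<le> x * (1 / real j ^ 2)"
      using counting_multiples_le[of "j ^ 2" x] assms(2)
      by (simp add: counting_def conj_ac)
  qed
  also have "\<dots> = x * (\<Sum>j\<in>{0..J}. 1 / real (j + N) ^ 2)"
    using sum.shift_bounds_cl_nat_ivl[of "\<lambda>j. 1 / real j ^ 2" 0 N J]
    by (simp only: sum_distrib_left[symmetric] add_0)
  also have "\<dots> \<le> x * (\<Sum>j. 1 / real (j + N) ^ 2)"
    using summable_ignore_initial_segment[OF summable_inverse_square, of N]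
    by (intro mult_left_mono sum_le_suminf assms) auto
  finally show ?thesis .
qed

abbreviation primes_below :: "nat \<Rightarrow> nat set" where
  "primes_below N \<equiv> {p. prime p \<and> p < N}"

lemma omega_exact_neq:
  assumes "k \<ge> 2" "omega_exact k n \<noteq> omega_on (primes_below N) k n"
  shows "\<exists>j\<ge>N. j ^ 2 dvd n"
proof (rule ccontr)
  assume no: "\<not> ?thesis"
  have "p < N" if "multiplicity p n = k" for p
  proof (rule ccontr)
    assume "\<not> p < N"
    moreover have "p ^ 2 dvd n"
      using assms(1) that by (intro multiplicity_dvd') auto
    ultimately show False using no by auto
  qed
  then have "{p. prime p \<and> multiplicity p n = k} = {p \<in> primes_below N. multiplicity p n = k}"
    by auto
  then show False using assms(2) by (simp add: omega_exact_def omega_on_def)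
qed

text \<open>The bound does not depend on \<open>x\<close>. This uniformity lets the limits in \<open>x\<close> and in \<open>N\<close> be
  exchanged.\<close>

lemma omega_truncation:
  assumes "k \<ge> 2" "N > 0" "x > 0"
  shows "\<bar>real (counting {n. omega_exact k n = m} x) / x
      - real (counting {n. omega_on (primes_below N) k n = m} x) / x\<bar>
    \<le> (\<Sum>j. 1 / real (j + N) ^ 2)"
proof -
  let ?A = "{n. omega_exact k n = m}" and ?B = "{n. omega_on (primes_below N) k n = m}"
  let ?T = "{n. \<exists>j\<ge>N. j ^ 2 dvd n}"
  have agree: "omega_exact k n = omega_on (primes_below N) k n" if "n \<notin> ?T" for n
    using omega_exact_neq[OF assms(1), of n N] that by blast
  have "?A \<subseteq> ?B \<union> ?T"
    using agree by force
  then have AB: "counting ?A x \<le> counting ?B x + counting ?T x"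
    by (rule order_trans[OF counting_mono counting_Un])
  have "?B \<subseteq> ?A \<union> ?T"
    using agree by force
  then have "counting ?B x \<le> counting ?A x + counting ?T x"
    by (rule order_trans[OF counting_mono counting_Un])
  with AB have "\<bar>real (counting ?A x) - real (counting ?B x)\<bar> \<le> real (counting ?T x)"
    by linarith
  also have "\<dots> \<le> x * (\<Sum>j. 1 / real (j + N) ^ 2)"
    using assms by (intro counting_square_multiples_le) auto
  finally have "\<bar>real (counting ?A x) - real (counting ?B x)\<bar> / x \<le> (\<Sum>j. 1 / real (j + N) ^ 2)"
    by (subst pos_divide_le_eq) (use assms in \<open>simp_all only: mult.commute\<close>)
  moreover have "\<bar>a / x - b / x\<bar> = \<bar>a - b\<bar> / x" for a b
    using assms(3) by (simp add: diff_divide_distrib[symmetric])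
  ultimately show ?thesis by simp
qed

text \<open>The convergence in \<open>N\<close> is itself part of the claim: the uniform bound makes the finite-level
  densities a Cauchy sequence, and exchanging limits then shows that the density of \<open>\<omega>\<^sub>k = m\<close> exists
  and has the same value.\<close>

lemma omega_density_limit:
  assumes k: "k \<ge> 2"
  shows "(\<lambda>N. coeff (bernoulli_gf k (primes_below N)) m) \<longlonglongrightarrow> omega_density k m"
proof -
  define F where "F x = real (counting {n. omega_exact k n = m} x) / x" for x
  define G where "G N x = real (counting {n. omega_on (primes_below N) k n = m} x) / x" for N x
  define c where "c N = coeff (bernoulli_gf k (primes_below N)) m" for N
  define \<epsilon> where "\<epsilon> N = (\<Sum>j. 1 / real (j + N) ^ 2)" for N
  have G: "(G N \<longlongrightarrow> c N) at_top" for N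
  proof -
    have "has_density {n. 0 < n \<and> omega_on (primes_below N) k n = m} (c N)"
      unfolding c_def by (rule has_density_omega_on) auto
    then show ?thesis
      unfolding has_density_def G_def counting_pos .
  qed
  have \<epsilon>: "\<epsilon> \<longlonglongrightarrow> 0"
    unfolding \<epsilon>_def by (rule suminf_exist_split2[OF summable_inverse_square])
  have close: "\<bar>F x - G N x\<bar> \<le> \<epsilon> N" if "N > 0" "x > 0" for N x
    unfolding F_def G_def \<epsilon>_def using k that by (rule omega_truncation)
  have unif: "uniform_limit {0<..} G F sequentially"
  proof (rule uniform_limitI)
    fix e :: real assume "e > 0"
    then have "\<forall>\<^sub>F N in sequentially. \<epsilon> N < e"
      using \<epsilon> by (rule order_tendstoD(2)[rotated])
    then show "\<forall>\<^sub>F N in sequentially. \<forall>x\<in>{0<..}. dist (G N x) (F x) < e"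
      using eventually_gt_at_top[of 0]
    proof eventually_elim
      case (elim N)
      show ?case
      proof
        fix x :: real assume "x \<in> {0<..}"
        then have "\<bar>F x - G N x\<bar> \<le> \<epsilon> N" using elim by (intro close) auto
        then show "dist (G N x) (F x) < e"
          using elim by (simp only: dist_real_def abs_minus_commute)
      qed
    qed
  qed
  have gap: "\<bar>c N - c M\<bar> \<le> \<epsilon> N + \<epsilon> M" if "N > 0" "M > 0" for N M
  proof (rule tendsto_upperbound)
    show "((\<lambda>x. \<bar>G N x - G M x\<bar>) \<longlongrightarrow> \<bar>c N - c M\<bar>) at_top"
      by (intro tendsto_intros G)
    show "\<forall>\<^sub>F x in at_top. \<bar>G N x - G M x\<bar> \<le> \<epsilon> N + \<epsilon> M"
      using eventually_gt_at_top[of 0]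
    proof eventually_elim
      case (elim x)
      then show ?case using close[OF that(1) elim] close[OF that(2) elim] by linarith
    qed
  qed simp
  have "Cauchy c"
  proof (rule metric_CauchyI)
    fix e :: real assume "e > 0"
    then have "\<forall>\<^sub>F N in sequentially. \<epsilon> N < e / 2"
      using \<epsilon> by (intro order_tendstoD(2)) auto
    then obtain K where K: "\<And>N. N \<ge> K \<Longrightarrow> \<epsilon> N < e / 2"
      by (auto simp: eventually_sequentially)
    have "dist (c N) (c M) < e" if "N \<ge> Suc K" "M \<ge> Suc K" for N M
      using gap[of N M] K[of N] K[of M] that by (simp add: dist_real_def)
    then show "\<exists>K. \<forall>N\<ge>K. \<forall>M\<ge>K. dist (c N) (c M) < e" by blast
  qed
  then obtain l where cl: "c \<longlonglongrightarrow> l"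
    using Cauchy_convergent_iff convergent_def by blast
  have Fl: "(F \<longlongrightarrow> l) at_top"
    by (rule swap_uniform_limit'[OF _ cl unif]) (simp_all add: G eventually_gt_at_top)
  have "omega_density k m = Lim at_top F"
    unfolding omega_density_def F_def counting_def by (simp add: conj_ac)
  also have "\<dots> = l" using Fl by (intro tendsto_Lim) auto
  finally show ?thesis using cl by (simp add: c_def[abs_def])
qed

section \<open>Moments\<close>

lemma coeff_sums_poly:
  fixes q :: "real poly"
  shows "(\<lambda>m. coeff q m * z ^ m) sums poly q z"
  unfolding poly_altdef by (rule sums_finite) (auto simp: coeff_eq_0)

lemma first_moment_sums: "(\<lambda>m. real m * coeff q m) sums poly (pderiv q) 1"
  using coeff_sums_poly[of "pderiv q" 1] sums_Suc_iff[of "\<lambda>m. real m * coeff q m"]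
  by (simp add: coeff_pderiv)

lemma second_factorial_moment_sums:
  "(\<lambda>m. real m * (real m - 1) * coeff q m) sums poly (pderiv (pderiv q)) 1"
  using first_moment_sums[of "pderiv q"] sums_Suc_iff[of "\<lambda>m. real m * (real m - 1) * coeff q m"]
  by (simp add: coeff_pderiv mult_ac)

text \<open>The second derivative collects the pairs of distinct factors, hence the subtracted diagonal.\<close>

lemma bernoulli_gf_at_1:
  assumes "finite P"
  shows "poly (bernoulli_gf k P) 1 = 1"
    and "poly (pderiv (bernoulli_gf k P)) 1 = (\<Sum>p\<in>P. exact_prob k p)"
    and "poly (pderiv (pderiv (bernoulli_gf k P))) 1 =
      (\<Sum>p\<in>P. exact_prob k p) ^ 2 - (\<Sum>p\<in>P. exact_prob k p ^ 2)"
proof -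
  have "poly (bernoulli_gf k P) 1 = 1 \<and>
    poly (pderiv (bernoulli_gf k P)) 1 = (\<Sum>p\<in>P. exact_prob k p) \<and>
    poly (pderiv (pderiv (bernoulli_gf k P))) 1 =
      (\<Sum>p\<in>P. exact_prob k p) ^ 2 - (\<Sum>p\<in>P. exact_prob k p ^ 2)"
    using assms
  proof (induction P rule: finite_induct)
    case empty
    then show ?case by (simp add: bernoulli_gf_def)
  next
    case (insert p P)
    have "bernoulli_gf k (insert p P) = [:1 - exact_prob k p, exact_prob k p:] * bernoulli_gf k P"
      using insert.hyps by (simp add: bernoulli_gf_def)
    then show ?case
      using insert
      by (simp add: pderiv_mult pderiv_add pderiv_pCons pderiv_smult power2_eq_square algebra_simps
          del: mult_pCons_left)
  qed
  then show "poly (bernoulli_gf k P) 1 = 1"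
    and "poly (pderiv (bernoulli_gf k P)) 1 = (\<Sum>p\<in>P. exact_prob k p)"
    and "poly (pderiv (pderiv (bernoulli_gf k P))) 1 =
      (\<Sum>p\<in>P. exact_prob k p) ^ 2 - (\<Sum>p\<in>P. exact_prob k p ^ 2)"
    by auto
qed

lemma coeff_bernoulli_gf_nonneg:
  assumes "finite P" "\<And>p. p \<in> P \<Longrightarrow> p > 0"
  shows "coeff (bernoulli_gf k P) m \<ge> 0"
  using assms
proof (induction P arbitrary: m rule: finite_induct)
  case empty
  then show ?case by (simp add: bernoulli_gf_def coeff_1)
next
  case (insert p P)
  have gf: "bernoulli_gf k (insert p P) = [:1 - exact_prob k p, exact_prob k p:] * bernoulli_gf k P"
    using insert.hyps by (simp add: bernoulli_gf_def)
  show ?case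
    using insert exact_prob_nonneg[of p k] exact_prob_le_1[of p k]
    by (auto simp: gf coeff_pCons split: nat.split)
qed

text \<open>The coefficients are nonnegative, so one term of the generating function at \<open>8\<close> is at most its
  value, and \<open>1 + 7 b\<^sub>p \<le> exp (7 b\<^sub>p)\<close> bounds that value by \<open>exp (7 \<Sum> 1 / j\<^sup>2)\<close>. The base \<open>8\<close> is chosen
  to beat \<open>m\<^sup>2 \<le> 4 ^ m\<close> and leave a convergent geometric series of ratio \<open>1 / 2\<close>.\<close>

lemma coeff_bernoulli_gf_geometric_bound:
  assumes k: "k \<ge> 2"
  obtains C where "\<And>N m. coeff (bernoulli_gf k (primes_below N)) m * 8 ^ m \<le> C"
proof
  fix N m
  let ?P = "primes_below N"
  let ?g = "bernoulli_gf k ?P"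
  have pos: "p > 0" if "p \<in> ?P" for p using that prime_gt_0_nat by auto
  have nonneg: "coeff ?g i * 8 ^ i \<ge> 0" for i
    using coeff_bernoulli_gf_nonneg[of ?P k i] pos by simp
  have "coeff ?g m * 8 ^ m = (\<Sum>i\<in>{m}. coeff ?g i * 8 ^ i)" by simp
  also have "\<dots> \<le> (\<Sum>i. coeff ?g i * 8 ^ i)"
    using coeff_sums_poly[of ?g 8] nonneg by (intro sum_le_suminf) (auto dest: sums_summable)
  also have "\<dots> = poly ?g 8"
    using coeff_sums_poly[of ?g 8] by (simp add: sums_iff)
  also have "\<dots> = (\<Prod>p\<in>?P. 1 + 7 * exact_prob k p)"
    unfolding bernoulli_gf_def poly_prod by (rule prod.cong) auto
  also have "\<dots> \<le> (\<Prod>p\<in>?P. exp (7 * exact_prob k p))"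
    using exact_prob_nonneg[of _ k] pos by (intro prod_mono) (auto simp: add_nonneg_nonneg exp_ge_add_one_self)
  also have "\<dots> = exp (7 * (\<Sum>p\<in>?P. exact_prob k p))"
    by (simp add: exp_sum sum_distrib_left)
  also have "(\<Sum>p\<in>?P. exact_prob k p) \<le> (\<Sum>p\<in>?P. 1 / real p ^ 2)"
  proof (rule sum_mono)
    fix p assume "p \<in> ?P"
    then have "p > 0" by (rule pos)
    then have "real p ^ 2 \<le> real p ^ k"
      using k by (intro power_increasing) auto
    then have "1 / real p ^ k \<le> 1 / real p ^ 2"
      using \<open>p > 0\<close> by (intro divide_left_mono) auto
    then show "exact_prob k p \<le> 1 / real p ^ 2"
      using exact_prob_le[OF \<open>p > 0\<close>, of k] by linarith
  qed
  also have "\<dots> \<le> (\<Sum>j. 1 / real j ^ 2)"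
    by (intro sum_le_suminf summable_inverse_square) auto
  finally show "coeff ?g m * 8 ^ m \<le> exp (7 * (\<Sum>j. 1 / real j ^ 2))" by simp
qed

text \<open>Convergence of each probability alone would not give convergence of moments; Tannery's theorem
  applies because of the uniform geometric bound.\<close>

lemma moments_tendsto:
  fixes f :: "nat \<Rightarrow> real"
  assumes k: "k \<ge> 2" and f: "\<And>m. \<bar>f m\<bar> \<le> real m ^ 2"
  shows "summable (\<lambda>m. f m * omega_density k m)"
    and "(\<lambda>N. \<Sum>m. f m * coeff (bernoulli_gf k (primes_below N)) m)
      \<longlonglongrightarrow> (\<Sum>m. f m * omega_density k m)"
proof -
  let ?c = "\<lambda>N m. coeff (bernoulli_gf k (primes_below N)) m"
  obtain C where C: "\<And>N m. ?c N m * 8 ^ m \<le> C"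
    using coeff_bernoulli_gf_geometric_bound[OF k] by blast
  have nonneg: "?c N m \<ge> 0" for N m
    by (rule coeff_bernoulli_gf_nonneg) (auto simp: prime_gt_0_nat)
  have sq: "real m ^ 2 \<le> 4 ^ m" for m
  proof -
    have "real m \<le> 2 ^ m" using of_nat_less_two_power[of m, where 'a=real] by linarith
    then have "real m ^ 2 \<le> (2 ^ m) ^ 2" by (intro power_mono) auto
    also have "(2 ^ m) ^ 2 = (4 :: real) ^ m" by (simp add: power2_eq_square flip: power_mult_distrib)
    finally show ?thesis .
  qed
  have bound: "norm (f m * ?c N m) \<le> C * (1 / 2) ^ m" for N m
  proof -
    have "norm (f m * ?c N m) = \<bar>f m\<bar> * ?c N m"
      using nonneg by (simp add: abs_mult)
    also have "\<dots> \<le> 4 ^ m * ?c N m"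
      using f[of m] sq[of m] nonneg by (intro mult_right_mono) auto
    also have "\<dots> = (?c N m * 8 ^ m) * (1 / 2) ^ m"
      by (simp add: power_mult_distrib[symmetric])
    also have "\<dots> \<le> C * (1 / 2) ^ m" by (intro mult_right_mono C) auto
    finally show ?thesis .
  qed
  have lim: "(\<lambda>N. f m * ?c N m) \<longlonglongrightarrow> f m * omega_density k m" for m
    by (intro tendsto_intros omega_density_limit k)
  have geo: "summable (\<lambda>m. C * (1 / 2) ^ m :: real)"
    by (intro summable_mult summable_geometric) auto
  have tannery: "(\<forall>\<^sub>F N in sequentially. summable (\<lambda>m. norm (f m * ?c N m))) \<and>
      summable (\<lambda>m. norm (f m * omega_density k m)) \<and>
      (\<lambda>N. \<Sum>m. f m * ?c N m) \<longlonglongrightarrow> (\<Sum>m. f m * omega_density k m)"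
    using bound by (intro tannerys_theorem[OF lim _ geo] always_eventually) auto
  show "summable (\<lambda>m. f m * omega_density k m)"
    using tannery by (blast intro: summable_norm_cancel)
  show "(\<lambda>N. \<Sum>m. f m * ?c N m) \<longlonglongrightarrow> (\<Sum>m. f m * omega_density k m)"
    using tannery by blast
qed

lemma discrete_expectation:
  fixes f e :: "nat \<Rightarrow> real"
  assumes "prob_space M" and X: "X \<in> measurable M (count_space UNIV)"
    and e: "\<And>m. measure M {w \<in> space M. X w = m} = e m"
    and f: "summable (\<lambda>m. \<bar>f m\<bar> * e m)"
  shows "integrable M (\<lambda>w. f (X w))"
    and "prob_space.expectation M (\<lambda>w. f (X w)) = (\<Sum>m. f m * e m)"
proof -
  interpret prob_space M by fact
  have e0: "e m \<ge> 0" for m using e[of m] by (metis measure_nonneg)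
  have law: "distr M (count_space UNIV) X = density (count_space UNIV) (\<lambda>m. ennreal (e m))"
  proof (rule measure_eqI_countable[of _ UNIV])
    fix m :: nat
    have "X -` {m} \<inter> space M = {w \<in> space M. X w = m}" by auto
    then show "emeasure (distr M (count_space UNIV) X) {m} =
        emeasure (density (count_space UNIV) (\<lambda>m. ennreal (e m))) {m}"
      using X by (simp add: emeasure_distr emeasure_density emeasure_eq_measure e
          nn_integral_count_space_indicator[symmetric] nn_integral_count_space_finite
           mult.commute)
  qed auto
  have "summable (\<lambda>m. \<bar>e m * f m\<bar>)" using f e0 by (simp add: abs_mult mult.commute)
  then have int: "integrable (count_space UNIV) (\<lambda>m. e m * f m)"
    by (simp add: integrable_count_space_nat_iff)
  have "integrable (density (count_space UNIV) (\<lambda>m. ennreal (e m))) f"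
    using int e0 by (subst integrable_density) auto
  then show "integrable M (\<lambda>w. f (X w))"
    using integrable_distr_eq[OF X, of f] by (simp add: law)
  have "expectation (\<lambda>w. f (X w)) = integral\<^sup>L (distr M (count_space UNIV) X) f"
    using X by (simp add: integral_distr)
  also have "\<dots> = (\<Sum>m. f m * e m)"
    using int e0 sums_integral_count_space_nat[OF int] unfolding law
    by (subst integral_density) (auto simp: sums_iff mult.commute)
  finally show "expectation (\<lambda>w. f (X w)) = (\<Sum>m. f m * e m)" .
qed

text \<open>Nonnegative terms make convergence in the natural order of the primes unconditional.\<close>

lemma has_sum_over_primes:
  fixes h :: "nat \<Rightarrow> real"
  assumes lim: "(\<lambda>N. \<Sum>p\<in>primes_below N. h p) \<longlonglongrightarrow> s"
    and nonneg: "\<And>p. prime p \<Longrightarrow> h p \<ge> 0"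
  shows "(h has_sum s) {p. prime p}"
proof -
  let ?h = "\<lambda>p. if prime p then h p else 0"
  have "(\<Sum>p\<in>primes_below N. h p) = (\<Sum>p<N. ?h p)" for N
    by (rule sum.mono_neutral_cong_left) auto
  then have "?h sums s" using lim by (simp add: sums_def)
  then have "(?h has_sum s) UNIV"
    using nonneg by (intro norm_summable_imp_has_sum) (auto simp: sums_iff cong: if_cong)
  then show ?thesis
    by (rule has_sum_cong_neutral[THEN iffD1, rotated -1]) auto
qed

theorem corollary6:
  fixes k :: nat and M :: "'a measure" and X :: "'a \<Rightarrow> nat"
  assumes "k \<ge> 2"
    and "prob_space M"
    and "X \<in> measurable M (count_space UNIV)"
    and "\<And>m. measure M {w \<in> space M. X w = m} = omega_density k m"
  shows "integrable M (\<lambda>w. real (X w)) \<and>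
         integrable M (\<lambda>w. (real (X w))\<^sup>2) \<and>
         ((\<lambda>p::nat. (real p - 1) / real p ^ (k + 1)) has_sum
           prob_space.expectation M (\<lambda>w. real (X w))) {p. prime p} \<and>
         ((\<lambda>p::nat. (real p - 1) / real p ^ (k + 1) * (1 - (real p - 1) / real p ^ (k + 1))) has_sum
           prob_space.variance M (\<lambda>w. real (X w))) {p. prime p}"
proof -
  interpret prob_space M by fact
  let ?b = "exact_prob k"
  let ?f1 = "\<lambda>m. real m" and ?f2 = "\<lambda>m. real m * (real m - 1)"
  have le: "\<bar>?f1 m\<bar> \<le> real m ^ 2" "\<bar>?f2 m\<bar> \<le> real m ^ 2" for m
    by (cases m; simp add: power2_eq_square algebra_simps)+
  note law = assms(2-4)
  have f2: "?f2 m \<ge> 0" for m by (cases m) auto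
  have int1: "integrable M (\<lambda>w. ?f1 (X w))" and E1: "expectation (\<lambda>w. ?f1 (X w)) = (\<Sum>m. ?f1 m * omega_density k m)"
    using moments_tendsto(1)[OF assms(1), of ?f1] le by (auto intro!: discrete_expectation[OF law])
  have int2: "integrable M (\<lambda>w. ?f2 (X w))" and E2: "expectation (\<lambda>w. ?f2 (X w)) = (\<Sum>m. ?f2 m * omega_density k m)"
    using moments_tendsto(1)[OF assms(1), of ?f2] le f2 by (auto intro!: discrete_expectation[OF law])
  have lim1: "(\<lambda>N. \<Sum>p\<in>primes_below N. ?b p) \<longlonglongrightarrow> expectation (\<lambda>w. ?f1 (X w))"
    using moments_tendsto(2)[OF assms(1), of ?f1] le(1)
    by (simp add: E1 sums_unique[OF first_moment_sums, symmetric] bernoulli_gf_at_1)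
  have lim2: "(\<lambda>N. (\<Sum>p\<in>primes_below N. ?b p) ^ 2 - (\<Sum>p\<in>primes_below N. ?b p ^ 2))
      \<longlonglongrightarrow> expectation (\<lambda>w. ?f2 (X w))"
    using moments_tendsto(2)[OF assms(1), of ?f2] le(2)
    by (simp add: E2 sums_unique[OF second_factorial_moment_sums, symmetric] bernoulli_gf_at_1)
  \<comment> \<open>Generating functions give the factorial moment of \<open>X (X - 1)\<close>; the square is recovered from it.\<close>
  have sq: "(\<lambda>w. (real (X w))\<^sup>2) = (\<lambda>w. ?f2 (X w) + ?f1 (X w))"
    by (auto simp: power2_eq_square algebra_simps)
  have intsq: "integrable M (\<lambda>w. (real (X w))\<^sup>2)"
    unfolding sq by (intro Bochner_Integration.integrable_add int1 int2)
  have "variance (\<lambda>w. real (X w)) = expectation (\<lambda>w. (real (X w))\<^sup>2) - (expectation (\<lambda>w. real (X w)))\<^sup>2"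
    using int1 intsq by (rule variance_eq)
  also have "expectation (\<lambda>w. (real (X w))\<^sup>2) = expectation (\<lambda>w. ?f2 (X w)) + expectation (\<lambda>w. ?f1 (X w))"
    unfolding sq by (rule Bochner_Integration.integral_add[OF int2 int1])
  finally have var: "variance (\<lambda>w. real (X w)) = expectation (\<lambda>w. ?f2 (X w)) + expectation (\<lambda>w. ?f1 (X w))
      - (expectation (\<lambda>w. ?f1 (X w)))\<^sup>2" .
  \<comment> \<open>With \<open>S = \<Sum> b\<^sub>p\<close>, the finite variance is \<open>(S\<^sup>2 - \<Sum> b\<^sub>p\<^sup>2) + S - S\<^sup>2\<close>.\<close>
  have "(\<lambda>N. \<Sum>p\<in>primes_below N. ?b p * (1 - ?b p)) \<longlonglongrightarrow> variance (\<lambda>w. real (X w))"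
    using tendsto_diff[OF tendsto_add[OF lim2 lim1] tendsto_power[OF lim1, of 2]]
    unfolding var by (simp add: right_diff_distrib sum_subtractf power2_eq_square)
  then have "((\<lambda>p. ?b p * (1 - ?b p)) has_sum variance (\<lambda>w. real (X w))) {p. prime p}"
    using exact_prob_nonneg[of _ k] exact_prob_le_1[of _ k] prime_gt_0_nat
    by (intro has_sum_over_primes) auto
  moreover have "(?b has_sum expectation (\<lambda>w. real (X w))) {p. prime p}"
    using exact_prob_nonneg[of _ k] prime_gt_0_nat lim1 by (intro has_sum_over_primes) auto
  ultimately show ?thesis
    using int1 intsq by (simp add: exact_prob_def[abs_def])
qed

end
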